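(* Let $P=(X,\prec)$ be a poset on $|X|=n$ elements. Fix elements $u_1\prec\dots\prec u_k$ of $X$ and integers $1\le a_1<\dots<a_k\le n$, and let $\mathcal E(P,\mathbf u,\mathbf a)$ be the set of linear extensions $f$ of $P$ such that $f(u_i)=a_i$ for all $1\le i\le k$. Then $|\mathcal E(P,\mathbf u,\mathbf a)|>0$ if and only if $$\ell(u_i)\le a_i\ \text{ and }\ b(u_i)\le n-a_i+1\quad\text{for all }1\le i\le k,$$ and $$a_j-a_i>h(u_i,u_j)\quad\text{for all }1\le i<j\le k.$$
   Context: A linear extension of $P$ is a bijection $f:X\to[n]$ with $f(x)<f(y)$ whenever $x\prec y$. For $x\in X$, $\ell(x):=|\{y\in X:y\preccurlyeq x\}|$ and $b(x):=|\{y\in X: y\succcurlyeq x\}|$. For $x\prec y$, $h(x,y):=|\{z\in X: x\prec z\prec y\}|$. *)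

theory Defs
  imports Main "HOL-Library.FuncSet"
begin

(* A poset on the carrier X is given by its reflexive order relation r with
   partial_order_on X r, so (x, y) \<in> r is the weak order of the poset. *)

definition strictly_below :: "'a rel \<Rightarrow> 'a \<Rightarrow> 'a \<Rightarrow> bool" where
  "strictly_below r x y \<longleftrightarrow> (x, y) \<in> r \<and> x \<noteq> y"

(* The extensional function space fixes the values outside X, so that distinct
   members of this set differ on X and its cardinality is the number of linear
   extensions. *)
definition linear_extensions :: "'a set \<Rightarrow> 'a rel \<Rightarrow> ('a \<Rightarrow> nat) set" where
  "linear_extensions X r =
     {f \<in> X \<rightarrow>\<^sub>E {1..card X}. bij_betw f X {1..card X} \<and>
        (\<forall>x\<in>X. \<forall>y\<in>X. strictly_below r x y \<longrightarrow> f x < f y)}"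

definition lower_count :: "'a set \<Rightarrow> 'a rel \<Rightarrow> 'a \<Rightarrow> nat" where
  "lower_count X r x = card {y \<in> X. (y, x) \<in> r}"

definition upper_count :: "'a set \<Rightarrow> 'a rel \<Rightarrow> 'a \<Rightarrow> nat" where
  "upper_count X r x = card {y \<in> X. (x, y) \<in> r}"

definition between_count :: "'a set \<Rightarrow> 'a rel \<Rightarrow> 'a \<Rightarrow> 'a \<Rightarrow> nat" where
  "between_count X r x y = card {z \<in> X. strictly_below r x z \<and> strictly_below r z y}"

(* Only the values u i and a i with 1 \<le> i \<le> k matter. *)
definition constrained_extensions ::
    "'a set \<Rightarrow> 'a rel \<Rightarrow> nat \<Rightarrow> (nat \<Rightarrow> 'a) \<Rightarrow> (nat \<Rightarrow> nat) \<Rightarrow> ('a \<Rightarrow> nat) set" where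
  "constrained_extensions X r k u a =
     {f \<in> linear_extensions X r. \<forall>i\<in>{1..k}. f (u i) = a i}"

end

theory Submission
  imports Defs
begin

text \<open>For sufficiency, the linear extension is built from the top by induction on the size of the
  poset: the value \<open>card X\<close> is given to a suitable maximal element \<open>x\<close>, which is then removed.
  Removing \<open>x\<close> preserves all the inequalities provided \<open>x\<close> lies above every prescribed element
  whose upper count inequality is tight, and provided \<open>x\<close> is itself prescribed only if its prescribed
  value is \<open>card X\<close>. If the greatest prescribed element \<open>m\<close> does not have value \<open>card X\<close>, such an \<open>x\<close>
  exists because otherwise everything above the greatest tight element would lie below \<open>m\<close>, and the
  inequality for the elements between the two would be violated.\<close>

section \<open>Extremal elements of finite orders and chains\<close>

lemma strictly_below_asymp_on:
  assumes "antisym r"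
  shows "asymp_on A (strictly_below r)"
  using assms by (auto simp: asymp_on_def strictly_below_def dest: antisymD)

lemma strictly_below_transp_on:
  assumes "antisym r" "trans r"
  shows "transp_on A (strictly_below r)"
  using assms unfolding transp_on_def strictly_below_def by (metis antisymD transD)

lemma exists_maximal_above:
  assumes "finite X" "antisym r" "trans r" "y \<in> X" "(y, y) \<in> r"
  obtains x where "x \<in> X" "(y, x) \<in> r" "\<And>z. z \<in> X \<Longrightarrow> \<not> strictly_below r x z"
proof -
  let ?Y = "{z \<in> X. (y, z) \<in> r}"
  obtain x where x: "x \<in> ?Y" "\<forall>z\<in>?Y. z \<noteq> x \<longrightarrow> \<not> strictly_below r x z"
    using Finite_Set.bex_max_element[of ?Y "strictly_below r"] assms
      strictly_below_asymp_on[of r] strictly_below_transp_on[of r] by auto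
  show thesis
  proof (rule that)
    \<comment> \<open>Anything above \<open>x\<close> is above \<open>y\<close> by transitivity, so
      maximality in the up-set of \<open>y\<close> is maximality in \<open>X\<close>.\<close>
    show "\<not> strictly_below r x z" if "z \<in> X" for z
      using that x assms(3) unfolding strictly_below_def by (auto dest: transD)
  qed (use x in auto)
qed

lemma exists_greatest_in_chain:
  assumes "finite C" "C \<noteq> {}" "antisym r" "trans r"
    and "\<And>c. c \<in> C \<Longrightarrow> (c, c) \<in> r"
    and "\<And>c d. c \<in> C \<Longrightarrow> d \<in> C \<Longrightarrow> (c, d) \<in> r \<or> (d, c) \<in> r"
  obtains m where "m \<in> C" "\<And>c. c \<in> C \<Longrightarrow> (c, m) \<in> r"
proof -
  have "totalp_on C (strictly_below r)"
    using assms(6) by (auto simp: totalp_on_def strictly_below_def)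
  then obtain m where "m \<in> C" "\<forall>c\<in>C. c \<noteq> m \<longrightarrow> strictly_below r c m"
    using Finite_Set.bex_greatest_element[of C "strictly_below r"] assms
      strictly_below_asymp_on[of r] strictly_below_transp_on[of r] by auto
  then have "m \<in> C" "(c, m) \<in> r" if "c \<in> C" for c
    using that assms(5) by (auto simp: strictly_below_def)
  then show thesis
    using that assms(2) by blast
qed

section \<open>Sufficiency: building an extension from the top\<close>

text \<open>The induction step of the construction: \<open>g\<close> takes values at most
  \<open>card X - 1\<close>, and since nothing lies above \<open>x\<close>, the only new order
  constraints are those with \<open>x\<close> as the larger element.\<close>

lemma linear_extension_insert_top:
  assumes "finite X" "x \<in> X" "\<And>z. z \<in> X \<Longrightarrow> \<not> strictly_below r x z"
    and g: "g \<in> linear_extensions (X - {x}) r"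
  shows "g(x := card X) \<in> linear_extensions X r"
proof -
  let ?f = "g(x := card X)"
  have pos: "card X > 0" and card: "card (X - {x}) = card X - 1"
    using assms(1,2) by (auto simp: card_gt_0_iff)
  have rng: "{1..card X} = {1..card X - 1} \<union> {card X}"
    using pos by auto
  have X: "(X - {x}) \<union> {x} = X" using assms(2) by auto
  have gP: "g \<in> (X - {x}) \<rightarrow>\<^sub>E {1..card X - 1}"
    and gb: "bij_betw g (X - {x}) {1..card X - 1}"
    and gm: "\<And>y z. y \<in> X - {x} \<Longrightarrow> z \<in> X - {x} \<Longrightarrow> strictly_below r y z \<Longrightarrow> g y < g z"
    using g unfolding linear_extensions_def card by auto
  have "bij_betw ?f (X - {x}) {1..card X - 1}"
    using gb by (subst bij_betw_cong[of _ _ g]) auto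
  moreover have "bij_betw ?f {x} {card X}" by (simp add: bij_betw_def)
  ultimately have "bij_betw ?f ((X - {x}) \<union> {x}) ({1..card X - 1} \<union> {card X})"
    by (rule bij_betw_combine) (use pos in auto)
  then have bij: "bij_betw ?f X {1..card X}"
    by (simp only: rng X)
  then have "?f \<in> X \<rightarrow> {1..card X}"
    by (rule bij_betw_imp_funcset)
  moreover have "?f \<in> extensional X"
    using gP assms(2) by (auto simp: PiE_def extensional_def)
  ultimately have "?f \<in> X \<rightarrow>\<^sub>E {1..card X}"
    by (simp add: PiE_def)
  moreover have "?f y < ?f z" if "y \<in> X" "z \<in> X" "strictly_below r y z" for y z
  proof -
    have "y \<noteq> x" using assms(3) that by blast
    moreover have "g y < card X" if "y \<noteq> x"
      using PiE_mem[OF gP, of y] \<open>y \<in> X\<close> that pos by simp linarith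
    ultimately show ?thesis using gm[of y z] that by (cases "z = x") simp_all
  qed
  ultimately show ?thesis using bij by (auto simp: linear_extensions_def)
qed

text \<open>The last two conclusions are what the induction needs: the value \<open>card X\<close>
  given to \<open>x\<close> must not contradict a prescription, and a tight upper count must drop
  together with \<open>card X\<close>.\<close>

lemma exists_removable_element:
  assumes fin: "finite X" and ne: "X \<noteq> {}" and anti: "antisym r" and tr: "trans r"
    and refl: "\<And>x. x \<in> X \<Longrightarrow> (x, x) \<in> r"
    and CX: "C \<subseteq> X"
    and chain: "\<And>c d. c \<in> C \<Longrightarrow> d \<in> C \<Longrightarrow> (c, d) \<in> r \<or> (d, c) \<in> r"
    and low: "\<And>c. c \<in> C \<Longrightarrow> lower_count X r c \<le> a c"
    and upp: "\<And>c. c \<in> C \<Longrightarrow> upper_count X r c + a c \<le> card X + 1"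
    and btw: "\<And>c d. c \<in> C \<Longrightarrow> d \<in> C \<Longrightarrow> strictly_below r c d \<Longrightarrow>
      between_count X r c d + a c < a d"
  obtains x where "x \<in> X" "\<And>z. z \<in> X \<Longrightarrow> \<not> strictly_below r x z"
    "x \<in> C \<Longrightarrow> a x = card X"
    "\<And>c. c \<in> C \<Longrightarrow> upper_count X r c + a c = card X + 1 \<Longrightarrow> (c, x) \<in> r"
proof (cases "C = {}")
  case True
  obtain y where "y \<in> X" using ne by auto
  then show thesis
    using exists_maximal_above[OF fin anti tr _ refl] that True by (metis empty_iff)
next
  case False
  have finC: "finite C" using CX fin finite_subset by auto
  obtain m where m: "m \<in> C" "\<And>c. c \<in> C \<Longrightarrow> (c, m) \<in> r"
    using exists_greatest_in_chain[OF finC False anti tr _ chain] refl CX by blast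
  have mX: "m \<in> X" using m CX by auto
  show thesis
  proof (cases "a m = card X")
    case True
    \<comment> \<open>The upper bound leaves room for \<open>m\<close> alone, so \<open>m\<close> is
      maximal. It serves as \<open>x\<close>, since all of \<open>C\<close> lies below it.\<close>
    have "card {y \<in> X. (m, y) \<in> r} \<le> 1"
      using upp[OF m(1)] True by (simp add: upper_count_def)
    then have "y = m" if "y \<in> X" "(m, y) \<in> r" for y
      using that mX refl fin by (auto simp: card_le_Suc0_iff_eq)
    then show thesis
      using that[of m] True m mX by (auto simp: strictly_below_def)
  next
    case am: False
    have "upper_count X r m > 0"
      using mX refl fin by (auto simp: upper_count_def card_gt_0_iff)
    with upp[OF m(1)] am have am: "a m < card X" by linarith
    define T where "T = {c \<in> C. upper_count X r c + a c = card X + 1}"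
    \<comment> \<open>A maximal \<open>x\<close> above such a \<open>y\<close> lies above all of
      \<open>T\<close>, and it avoids \<open>C\<close> because every member of \<open>C\<close> is
      below \<open>m\<close>.\<close>
    have "\<exists>y\<in>X. (\<forall>c\<in>T. (c, y) \<in> r) \<and> (y, m) \<notin> r"
    proof (rule ccontr)
      assume "\<not> ?thesis"
      then have below: "(y, m) \<in> r" if "y \<in> X" "\<And>c. c \<in> T \<Longrightarrow> (c, y) \<in> r" for y
        using that by blast
      show False
      proof (cases "T = {}")
        case True
        \<comment> \<open>With no tight element all of \<open>X\<close> lies below \<open>m\<close>,
          so its lower count is \<open>card X\<close>, which exceeds \<open>a m\<close>.\<close>
        then have "{y \<in> X. (y, m) \<in> r} = X" using below by auto
        then show False using low[OF m(1)] am by (simp add: lower_count_def)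
      next
        case False
        have "finite T" using finC by (auto simp: T_def)
        then obtain t where t: "t \<in> T" "\<And>c. c \<in> T \<Longrightarrow> (c, t) \<in> r"
          using exists_greatest_in_chain[OF _ False anti tr] chain refl CX
          unfolding T_def by (smt (verit) mem_Collect_eq subsetD)
        have tC: "t \<in> C" and tight: "upper_count X r t + a t = card X + 1"
          using t(1) by (auto simp: T_def)
        have up: "(y, m) \<in> r" if "y \<in> X" "(t, y) \<in> r" for y
          using below[OF that(1)] t(2) that(2) tr by (meson transD)
        show False
        proof (cases "t = m")
          case True
          \<comment> \<open>An upper count of at most 1 at the tight element \<open>m\<close> would
            force \<open>a m\<close> to be at least \<open>card X\<close>.\<close>
          then have "{y \<in> X. (t, y) \<in> r} \<subseteq> {m}"
            using up anti by (auto dest: antisymD)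
          then have "upper_count X r t \<le> 1"
            unfolding upper_count_def using card_mono[of "{m}"] by fastforce
          then show False using tight True am by simp
        next
          case False
          let ?B = "{z \<in> X. strictly_below r t z \<and> strictly_below r z m}"
          \<comment> \<open>The up-set of \<open>t\<close> consists of elements between
            \<open>t\<close> and \<open>m\<close> and the two endpoints. Tightness then bounds
            \<open>card X + 1\<close> by \<open>between_count X r t m + 2 + a t\<close>, whereas
            \<open>between_count X r t m + a t < a m < card X\<close> makes the latter at most
            \<open>card X\<close>.\<close>
          have "{y \<in> X. (t, y) \<in> r} \<subseteq> insert t (insert m ?B)"
            using up by (auto simp: strictly_below_def)
          then have "upper_count X r t \<le> card (insert t (insert m ?B))"
            unfolding upper_count_def using fin by (intro card_mono) auto
          also have "\<dots> \<le> between_count X r t m + 2"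
            using fin by (simp add: between_count_def card_insert_if)
          finally have "upper_count X r t \<le> between_count X r t m + 2" .
          moreover have "between_count X r t m + a t < a m"
            using btw[OF tC m(1)] m(2)[OF tC] False by (auto simp: strictly_below_def)
          ultimately show False using tight am by linarith
        qed
      qed
    qed
    then obtain y where y: "y \<in> X" "\<And>c. c \<in> T \<Longrightarrow> (c, y) \<in> r" "(y, m) \<notin> r" by blast
    obtain x where x: "x \<in> X" "(y, x) \<in> r" "\<And>z. z \<in> X \<Longrightarrow> \<not> strictly_below r x z"
      using exists_maximal_above[OF fin anti tr y(1) refl[OF y(1)]] by blast
    show thesis
    proof (rule that[OF x(1,3)])
      \<comment> \<open>The premise is contradictory: it would put \<open>y\<close> below
        \<open>x\<close> and \<open>x\<close> below \<open>m\<close>.\<close>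
      show "a x = card X" if "x \<in> C"
        using m(2)[OF that] y(3) x(2) tr by (meson transD)
      show "(c, x) \<in> r" if "c \<in> C" "upper_count X r c + a c = card X + 1" for c
        using y(2)[of c] that x(2) tr unfolding T_def by (auto dest: transD)
    qed auto
  qed
qed

text \<open>Values are attached to the elements of a chain \<open>C\<close> instead of to indices,
  so that the induction can delete an element from both \<open>X\<close> and \<open>C\<close> while
  keeping \<open>a\<close> fixed.\<close>

lemma exists_linear_extension_with_values:
  assumes "finite X" "antisym r" "trans r"
    and "\<And>x. x \<in> X \<Longrightarrow> (x, x) \<in> r"
    and "C \<subseteq> X"
    and "\<And>c d. c \<in> C \<Longrightarrow> d \<in> C \<Longrightarrow> (c, d) \<in> r \<or> (d, c) \<in> r"
    and "\<And>c. c \<in> C \<Longrightarrow> lower_count X r c \<le> a c"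
    and "\<And>c. c \<in> C \<Longrightarrow> upper_count X r c + a c \<le> card X + 1"
    and "\<And>c d. c \<in> C \<Longrightarrow> d \<in> C \<Longrightarrow> strictly_below r c d \<Longrightarrow>
      between_count X r c d + a c < a d"
  shows "\<exists>f\<in>linear_extensions X r. \<forall>c\<in>C. f c = a c"
  using assms
proof (induction "card X" arbitrary: X C)
  case 0
  then show ?case
    by (auto simp: linear_extensions_def bij_betw_def intro!: bexI[of _ "\<lambda>_. undefined"])
next
  case (Suc n)
  note fin = Suc.prems(1) and refl = Suc.prems(4) and CX = Suc.prems(5)
  have "X \<noteq> {}" using Suc.hyps(2) by auto
  then obtain x where x: "x \<in> X" "\<And>z. z \<in> X \<Longrightarrow> \<not> strictly_below r x z"
    and xC: "x \<in> C \<Longrightarrow> a x = card X"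
    and xT: "\<And>c. c \<in> C \<Longrightarrow> upper_count X r c + a c = card X + 1 \<Longrightarrow> (c, x) \<in> r"
    using exists_removable_element[OF fin _ Suc.prems(2-9)] by blast
  let ?X = "X - {x}" and ?C = "C - {x}"
  have card: "card X = Suc (card ?X)"
    using x(1) fin by (metis card_Suc_Diff1)
  have "\<exists>g\<in>linear_extensions ?X r. \<forall>c\<in>?C. g c = a c"
  proof (rule Suc.hyps(1))
    show "n = card ?X" using card Suc.hyps(2) by simp
    \<comment> \<open>Deleting \<open>x\<close> can only decrease the lower and between counts, and
      the prescribed values stay the same.\<close>
    show "lower_count ?X r c \<le> a c" if "c \<in> ?C" for c
    proof -
      have "lower_count ?X r c \<le> lower_count X r c"
        unfolding lower_count_def using fin by (intro card_mono) auto
      then show ?thesis using Suc.prems(7)[of c] that by auto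
    qed
    show "between_count ?X r c d + a c < a d"
      if "c \<in> ?C" "d \<in> ?C" "strictly_below r c d" for c d
    proof -
      have "between_count ?X r c d \<le> between_count X r c d"
        unfolding between_count_def using fin by (intro card_mono) auto
      then show ?thesis using Suc.prems(9)[of c d] that by auto
    qed
    show "upper_count ?X r c + a c \<le> card ?X + 1" if "c \<in> ?C" for c
    \<comment> \<open>The right-hand side drops by one. Either \<open>x\<close> was counted above
      \<open>c\<close>, so the left-hand side drops too, or the choice of \<open>x\<close> ensures
      that the old inequality was strict.\<close>
    proof (cases "(c, x) \<in> r")
      case True
      have "{y \<in> ?X. (c, y) \<in> r} = {y \<in> X. (c, y) \<in> r} - {x}" by auto
      moreover have "x \<in> {y \<in> X. (c, y) \<in> r}" using True x(1) by simp
      ultimately have "Suc (upper_count ?X r c) = upper_count X r c"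
        using fin card_Suc_Diff1[of "{y \<in> X. (c, y) \<in> r}" x] by (simp add: upper_count_def)
      then show ?thesis using Suc.prems(8)[of c] that card by auto
    next
      case False
      then have "{y \<in> ?X. (c, y) \<in> r} = {y \<in> X. (c, y) \<in> r}" by auto
      then have "upper_count ?X r c = upper_count X r c" by (simp add: upper_count_def)
      moreover have "upper_count X r c + a c \<noteq> card X + 1" using xT[of c] False that by auto
      ultimately show ?thesis using Suc.prems(8)[of c] that card by auto
    qed
  qed (use Suc.prems in auto)
  then obtain g where g: "g \<in> linear_extensions ?X r" "\<forall>c\<in>?C. g c = a c" by blast
  have "g(x := card X) \<in> linear_extensions X r"
    using linear_extension_insert_top[OF fin x g(1)] .
  moreover have "\<forall>c\<in>C. (g(x := card X)) c = a c"
    using g(2) xC by auto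
  ultimately show ?case by blast
qed

section \<open>Necessity: counting inequalities for a linear extension\<close>

context
  fixes X :: "'a set" and r :: "'a rel" and f :: "'a \<Rightarrow> nat"
  assumes fin: "finite X" and f: "f \<in> linear_extensions X r"
begin

lemma linear_extension_inj_on: "inj_on f X"
  and linear_extension_range: "x \<in> X \<Longrightarrow> f x \<in> {1..card X}"
  and linear_extension_strict: "x \<in> X \<Longrightarrow> y \<in> X \<Longrightarrow> strictly_below r x y \<Longrightarrow> f x < f y"
  and linear_extension_mono: "x \<in> X \<Longrightarrow> y \<in> X \<Longrightarrow> (x, y) \<in> r \<Longrightarrow> f x \<le> f y"
  using f by (fastforce simp: linear_extensions_def bij_betw_def strictly_below_def)+

text \<open>\<open>f\<close> maps the down-set of \<open>x\<close> injectively into the interval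
  from 1 to \<open>f x\<close>. The next two bounds arise likewise from the interval from
  \<open>f x\<close> to \<open>card X\<close> and from the open interval between \<open>f x\<close>
  and \<open>f y\<close>.\<close>

lemma lower_count_le_linear_extension:
  assumes "x \<in> X"
  shows "lower_count X r x \<le> f x"
proof -
  have "card {y \<in> X. (y, x) \<in> r} \<le> card {1..f x}"
    using assms linear_extension_range linear_extension_mono
    by (intro card_inj_on_le[of f] inj_on_subset[OF linear_extension_inj_on]) auto
  then show ?thesis by (simp add: lower_count_def)
qed

lemma upper_count_le_linear_extension:
  assumes "x \<in> X"
  shows "upper_count X r x + f x \<le> card X + 1"
proof -
  have "card {y \<in> X. (x, y) \<in> r} \<le> card {f x..card X}"
    using assms linear_extension_range linear_extension_mono
    by (intro card_inj_on_le[of f] inj_on_subset[OF linear_extension_inj_on]) auto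
  then show ?thesis
    using linear_extension_range[OF assms] by (auto simp: upper_count_def)
qed

lemma between_count_less_linear_extension:
  assumes "x \<in> X" "y \<in> X" "strictly_below r x y"
  shows "between_count X r x y + f x < f y"
proof -
  have "card {z \<in> X. strictly_below r x z \<and> strictly_below r z y} \<le> card {f x<..<f y}"
    using assms linear_extension_strict
    by (intro card_inj_on_le[of f] inj_on_subset[OF linear_extension_inj_on]) auto
  then show ?thesis
    using linear_extension_strict[OF assms] by (auto simp: between_count_def)
qed

end

section \<open>The equivalence\<close>

text \<open>Infinite sets have \<open>card\<close> equal to 0, so finiteness is what lets positive
  cardinality express nonemptiness.\<close>

lemma finite_constrained_extensions:
  assumes "finite X"
  shows "finite (constrained_extensions X r k u a)"
proof (rule finite_subset)
  show "constrained_extensions X r k u a \<subseteq> X \<rightarrow>\<^sub>E {1..card X}"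
    by (auto simp: constrained_extensions_def linear_extensions_def)
  show "finite (X \<rightarrow>\<^sub>E {1..card X})" using assms by (intro finite_PiE) auto
qed

theorem theorem1p10:
  fixes X :: "'a set" and r :: "'a rel" and n k :: nat
    and u :: "nat \<Rightarrow> 'a" and a :: "nat \<Rightarrow> nat"
  assumes "finite X" and "card X = n" and "partial_order_on X r"
    and "\<And>i. i \<in> {1..k} \<Longrightarrow> u i \<in> X"
    and "\<And>i j. 1 \<le> i \<Longrightarrow> i < j \<Longrightarrow> j \<le> k \<Longrightarrow> strictly_below r (u i) (u j)"
    and "\<And>i. i \<in> {1..k} \<Longrightarrow> 1 \<le> a i \<and> a i \<le> n"
    and "strict_mono_on {1..k} a"
  shows "card (constrained_extensions X r k u a) > 0 \<longleftrightarrow>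
    (\<forall>i\<in>{1..k}. lower_count X r (u i) \<le> a i \<and>
                int (upper_count X r (u i)) \<le> int n - int (a i) + 1) \<and>
    (\<forall>i j. 1 \<le> i \<and> i < j \<and> j \<le> k \<longrightarrow>
       int (a j) - int (a i) > int (between_count X r (u i) (u j)))"
proof -
  note fin = \<open>finite X\<close> and n = \<open>card X = n\<close> and uX = assms(4) and u = assms(5)
  have anti: "antisym r" and tr: "trans r" and refl: "\<And>x. x \<in> X \<Longrightarrow> (x, x) \<in> r"
    using assms(3) by (auto simp: partial_order_on_def preorder_on_def refl_on_def)
  \<comment> \<open>The inequalities are moved from integer differences to sums of natural numbers,
    the form used by the lemmas above.\<close>
  have "constrained_extensions X r k u a \<noteq> {} \<longleftrightarrow>
    (\<forall>i\<in>{1..k}. lower_count X r (u i) \<le> a i \<and> upper_count X r (u i) + a i \<le> n + 1) \<and>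
    (\<forall>i j. 1 \<le> i \<and> i < j \<and> j \<le> k \<longrightarrow> between_count X r (u i) (u j) + a i < a j)"
    (is "_ \<longleftrightarrow> ?R")
  proof
    assume "constrained_extensions X r k u a \<noteq> {}"
    then obtain f where f: "f \<in> linear_extensions X r"
      and fa: "\<And>i. i \<in> {1..k} \<Longrightarrow> f (u i) = a i"
      by (auto simp: constrained_extensions_def)
    show ?R
    proof (intro conjI ballI allI impI)
      fix i assume i: "i \<in> {1..k}"
      show "lower_count X r (u i) \<le> a i"
        using lower_count_le_linear_extension[OF fin f uX[OF i]] fa[OF i] by simp
      show "upper_count X r (u i) + a i \<le> n + 1"
        using upper_count_le_linear_extension[OF fin f uX[OF i]] fa[OF i] n by simp
    next
      fix i j assume "1 \<le> i \<and> i < j \<and> j \<le> k"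
      then show "between_count X r (u i) (u j) + a i < a j"
        using between_count_less_linear_extension[OF fin f uX[of i] uX[of j] u[of i j]] fa[of i] fa[of j]
        by auto
    qed
  next
    assume R: ?R
    have inj: "inj_on u {1..k}"
      by (rule linorder_inj_onI) (use u in \<open>auto simp: strictly_below_def\<close>)
    \<comment> \<open>\<open>b\<close> transports the values from indices to elements, which is
      consistent because \<open>u\<close> is injective on the indices.\<close>
    define b where "b = a \<circ> inv_into {1..k} u"
    have b: "b (u i) = a i" if "i \<in> {1..k}" for i
      using inj that by (simp add: b_def)
    \<comment> \<open>The chain order reflects the index order, so the condition on index pairs
      covers every comparable pair of chain elements.\<close>
    have index_less: "i < j" if "i \<in> {1..k}" "j \<in> {1..k}" "strictly_below r (u i) (u j)" for i j
      using that u[of j i] anti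
      by (cases i j rule: linorder_cases) (auto simp: strictly_below_def dest: antisymD)
    have "\<exists>f\<in>linear_extensions X r. \<forall>c\<in>u ` {1..k}. f c = b c"
    proof (rule exists_linear_extension_with_values[OF fin anti tr refl])
      show "u ` {1..k} \<subseteq> X" using uX by auto
      show "(c, d) \<in> r \<or> (d, c) \<in> r" if cd: "c \<in> u ` {1..k}" "d \<in> u ` {1..k}" for c d
      proof -
        obtain i j where ij: "i \<in> {1..k}" "j \<in> {1..k}" "c = u i" "d = u j" using cd by auto
        then show ?thesis
          using u[of i j] u[of j i] refl[OF uX]
          by (cases i j rule: linorder_cases) (auto simp: strictly_below_def)
      qed
      show "between_count X r c d + b c < b d"
        if cd: "c \<in> u ` {1..k}" "d \<in> u ` {1..k}" "strictly_below r c d" for c d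
      proof -
        obtain i j where ij: "i \<in> {1..k}" "j \<in> {1..k}" "c = u i" "d = u j" using cd by auto
        then show ?thesis using R index_less[of i j] cd(3) b by auto
      qed
    qed (use R b n in auto)
    then show "constrained_extensions X r k u a \<noteq> {}"
      using b by (fastforce simp: constrained_extensions_def)
  qed
  moreover have "card (constrained_extensions X r k u a) > 0 \<longleftrightarrow>
    constrained_extensions X r k u a \<noteq> {}"
    using finite_constrained_extensions[OF fin] by (auto simp: card_gt_0_iff)
  moreover have "int p \<le> int n - int q + 1 \<longleftrightarrow> p + q \<le> n + 1"
    "int q' - int q > int p \<longleftrightarrow> p + q < q'" for p q q'
    by linarith+
  ultimately show ?thesis by simp
qed

end
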